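(* Let $k\ge1$ and $d\in\mathbb{N}$. For $0<q\le p\le\infty$ and every $\hat v\in\mathbb{Q}_k(\hat T)$, $\hat T=[-1,1]^d$, $$\|\hat v\|_{0,p,\hat T}\le\big((q+1)k^2\big)^{-d(1/p-1/q)}\,\|\hat v\|_{0,q,\hat T}.$$
   Context: $\mathbb{Q}_k(\hat T)$ is the span of the monomials $\hat x^\alpha$, $\alpha\in\mathbb{N}_0^d$, $\|\alpha\|_{\ell^\infty}\le k$. $\|\hat v\|_{0,p,\hat T}=\big(\int_{\hat T}|\hat v|^p\,d\hat x\big)^{1/p}$ for $0<p<\infty$ (a quasinorm if $p<1$) and $\|\hat v\|_{0,\infty,\hat T}=\max_{\hat T}|\hat v|$. Conventions: $1/\infty=0$, and the factor is $1$ if $p=q=\infty$. *)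

theory Defs
  imports "HOL-Analysis.Analysis" "HOL-Library.Function_Algebras"
begin

definition ref_cube :: "(real ^ 'n) set" where
  "ref_cube = cbox (\<chi> i. - 1) (\<chi> i. 1)"

definition monomial :: "nat ^ 'n \<Rightarrow> real ^ 'n \<Rightarrow> real" where
  "monomial \<alpha> = (\<lambda>x. \<Prod>i\<in>UNIV. (x $ i) ^ (\<alpha> $ i))"

(* The function space is not an instance of real_vector, hence the span of the locale
   module with pointwise scaling; pointwise addition comes from Function_Algebras. *)
definition Qk :: "nat \<Rightarrow> (real ^ 'n \<Rightarrow> real) set" where
  "Qk k = module.span (\<lambda>(c::real) f x. c * f x) {monomial \<alpha> |\<alpha>. \<forall>i. \<alpha> $ i \<le> k}"

(* For continuous v the supremum in the case p = \<infinity> is a maximum, see Lnorm_infinity_max. *)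
definition Lnorm :: "ereal \<Rightarrow> (real ^ 'n \<Rightarrow> real) \<Rightarrow> real" where
  "Lnorm p v =
    (if p = \<infinity> then SUP x\<in>ref_cube. \<bar>v x\<bar>
     else (LINT x:ref_cube|lborel. \<bar>v x\<bar> powr real_of_ereal p) powr (1 / real_of_ereal p))"

lemma module_pointwise: "module (\<lambda>(c::real) (f :: 'a \<Rightarrow> real) x. c * f x)"
  by unfold_locales (auto simp: fun_eq_iff algebra_simps)

lemma Qk_iff:
  fixes v :: "real ^ 'n \<Rightarrow> real"
  shows "v \<in> Qk k \<longleftrightarrow>
    (\<exists>S c. finite S \<and> (\<forall>\<alpha>\<in>S. \<forall>i. \<alpha> $ i \<le> k) \<and>
      v = (\<lambda>x. \<Sum>\<alpha>\<in>S. c \<alpha> * monomial \<alpha> x))" (is "?L \<longleftrightarrow> ?R")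
proof
  interpret module "\<lambda>(c::real) (f :: real ^ 'n \<Rightarrow> real) x. c * f x"
    by (rule module_pointwise)
  let ?A = "{\<alpha> :: nat ^ 'n. \<forall>i. \<alpha> $ i \<le> k}"
  have im: "{monomial \<alpha> |\<alpha>. \<forall>i. \<alpha> $ i \<le> k} = monomial ` ?A"
    by auto
  have sum_apply: "(\<Sum>a\<in>S. f a) x = (\<Sum>a\<in>S. f a x)"
    for f :: "'c \<Rightarrow> real ^ 'n \<Rightarrow> real" and S x
    by (induction S rule: infinite_finite_induct) auto
  {
    assume ?L
    then obtain t r where t: "finite t" "t \<subseteq> monomial ` ?A"
      and v: "v = (\<Sum>a\<in>t. (\<lambda>x. r a * a x))"
      unfolding Qk_def im span_explicit by blast
    obtain S where S: "S \<subseteq> ?A" "inj_on monomial S" "t = monomial ` S"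
      using t(2) by (meson subset_image_inj)
    have "finite S" using S t(1) finite_imageD by blast
    moreover have "v = (\<lambda>x. \<Sum>\<alpha>\<in>S. r (monomial \<alpha>) * monomial \<alpha> x)"
      unfolding v S(3) by (rule ext) (simp add: sum_apply sum.reindex[OF S(2)])
    ultimately show ?R using S(1)
      by (intro exI[of _ S] exI[of _ "\<lambda>\<alpha>. r (monomial \<alpha>)"]) auto
  next
    assume ?R
    then obtain S c where S: "finite S" "S \<subseteq> ?A"
      and v: "v = (\<lambda>x. \<Sum>\<alpha>\<in>S. c \<alpha> * monomial \<alpha> x)" by auto
    have "(\<Sum>\<alpha>\<in>S. (\<lambda>x. c \<alpha> * monomial \<alpha> x)) \<in> span (monomial ` ?A)"
      using S(2) by (intro span_sum span_scale span_base) auto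
    moreover have "v = (\<Sum>\<alpha>\<in>S. (\<lambda>x. c \<alpha> * monomial \<alpha> x))"
      unfolding v by (rule ext) (simp add: sum_apply)
    ultimately show ?L unfolding Qk_def im by simp
  }
qed

lemma Lnorm_infinity_max:
  fixes v :: "real ^ 'n \<Rightarrow> real"
  assumes "continuous_on ref_cube v"
  shows "\<exists>x\<in>ref_cube. Lnorm \<infinity> v = \<bar>v x\<bar> \<and> (\<forall>y\<in>ref_cube. \<bar>v y\<bar> \<le> \<bar>v x\<bar>)"
proof -
  have "(0 :: real ^ 'n) \<in> ref_cube"
    by (simp add: ref_cube_def mem_box_cart)
  then have ne: "(ref_cube :: (real ^ 'n) set) \<noteq> {}"
    by blast
  have "compact (ref_cube :: (real ^ 'n) set)"
    unfolding ref_cube_def by (rule compact_cbox)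
  moreover have "continuous_on ref_cube (\<lambda>x. \<bar>v x\<bar>)"
    using assms by (intro continuous_intros)
  ultimately obtain x where x: "x \<in> ref_cube" "\<forall>y\<in>ref_cube. \<bar>v y\<bar> \<le> \<bar>v x\<bar>"
    using continuous_attains_sup ne by blast
  then have "(SUP y\<in>ref_cube. \<bar>v y\<bar>) = \<bar>v x\<bar>"
    by (intro cSup_eq_maximum) auto
  then show ?thesis using x by (auto simp: Lnorm_def)
qed

end

theory Submission
  imports Defs
begin

text \<open>For a polynomial \<open>f\<close> of degree at most \<open>k\<close> with \<open>\<bar>f\<bar> \<le> M = f (cos \<theta>)\<close> on \<open>[-1,1]\<close>, an
  argument of M. Riesz gives \<open>f (cos (\<theta> + \<phi>)) \<ge> M cos (k\<phi>)\<close> for \<open>\<bar>\<phi>\<bar> < \<pi>/k\<close>. Otherwise the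
  trigonometric polynomial \<open>M cos (kt) - f (cos (\<theta> + t))\<close>, which has a double zero at \<open>t = 0\<close>,
  would have alternating signs at the \<open>2k\<close> points \<open>\<phi>, \<pi>/k, 2\<pi>/k, \<dots>, (2k-1)\<pi>/k\<close>; the substitution
  \<open>u = cot (t/2)\<close> turns it into an algebraic polynomial of degree at most \<open>2k - 2\<close>, for which this
  is impossible. Consequently \<open>\<bar>f x\<bar> \<ge> M (1 - k\<^sup>2 \<bar>x - y\<bar>)\<close> near a maximum point \<open>y\<close> of \<open>\<bar>f\<bar>\<close>, and
  integrating the \<open>q\<close>-th power over an interval of length \<open>1/k\<^sup>2\<close> on one side of \<open>y\<close> yields
  \<open>M\<^sup>q \<le> (q + 1) k\<^sup>2 \<integral> \<bar>f\<bar>\<^sup>q\<close>. Applying this in each coordinate settles \<open>p = \<infinity>\<close>, and for \<open>p < \<infinity>\<close>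
  one estimates \<open>\<bar>v\<bar>\<^sup>p \<le> (max \<bar>v\<bar>)\<^sup>p\<^sup>-\<^sup>q \<bar>v\<bar>\<^sup>q\<close>.\<close>

section \<open>Chebyshev polynomials and sign alternation\<close>

lemma Chebyshev_poly_exists:
  "\<exists>T :: real poly. degree T \<le> n \<and> (\<forall>t. poly T (cos t) = cos (real n * t))"
proof (induction n rule: induct_nat_012)
  case 0
  show ?case by (intro exI[of _ 1]) auto
next
  case 1
  show ?case by (intro exI[of _ "[:0, 1:]"]) auto
next
  case (ge2 n)
  then obtain S T :: "real poly"
    where S: "degree S \<le> n" "\<And>t. poly S (cos t) = cos (real n * t)"
      and T: "degree T \<le> Suc n" "\<And>t. poly T (cos t) = cos (real (Suc n) * t)"
    by auto
  have "degree ([:0, 2:] * T - S) \<le> Suc (Suc n)"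
    using S(1) T(1) degree_mult_le[of "[:0, 2:]" T] by (intro degree_diff_le) auto
  moreover have "poly ([:0, 2:] * T - S) (cos t) = cos (real (Suc (Suc n)) * t)" for t
  proof -
    have "cos (real (Suc (Suc n)) * t) = cos (real (Suc n) * t + t)"
      and "cos (real n * t) = cos (real (Suc n) * t - t)"
      by (simp_all add: algebra_simps)
    then show ?thesis
      unfolding poly_diff poly_mult S(2) T(2) cos_add cos_diff by simp
  qed
  ultimately show ?case by blast
qed

text \<open>The \<open>m\<close>-th divided difference of \<open>F\<close> at the
  \<open>m + 1\<close> nodes is the sum of the terms \<open>poly F (u i) / w i\<close>, and it
  vanishes because the degree is below \<open>m\<close>. The weights \<open>w i\<close> alternate in
  sign just as the values do, so every summand is nonnegative and hence zero.\<close>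

lemma alternating_signs_imp_root:
  fixes F :: "real poly" and u :: "nat \<Rightarrow> real"
  assumes deg: "degree F < m"
    and anti: "\<And>i j. i < j \<Longrightarrow> j \<le> m \<Longrightarrow> u j < u i"
    and alt: "\<And>i. i \<le> m \<Longrightarrow> (-1) ^ i * poly F (u i) \<ge> 0"
  shows "poly F (u 0) = 0"
proof -
  define w where "w i = (\<Prod>j\<in>{..m} - {i}. u i - u j)" for i
  define b where "b i = (\<Prod>j\<in>{..m} - {i}. [:- u j, 1:])" for i
  have inj: "u i \<noteq> u j" if "i \<le> m" "j \<le> m" "i \<noteq> j" for i j
    using anti[of i j] anti[of j i] that by (cases i j rule: linorder_cases) auto
  have w0: "w i \<noteq> 0" if "i \<le> m" for i
    using inj that by (auto simp: w_def)
  have deg_b: "degree (b i) = m" and lc_b: "coeff (b i) m = 1" if "i \<le> m" for i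
  proof -
    show d: "degree (b i) = m"
      using that by (simp add: b_def degree_prod_eq_sum_degree)
    have "lead_coeff (b i) = 1" by (simp add: b_def lead_coeff_prod)
    then show "coeff (b i) m = 1" by (simp add: d)
  qed
  have poly_b: "poly (b i) (u j) = (if i = j then w i else 0)" if "i \<le> m" "j \<le> m" for i j
    using that by (auto simp: b_def w_def poly_prod)
  \<comment> \<open>The Lagrange interpolant. It coincides with \<open>F\<close>, and its
    coefficient of order \<open>m\<close> is the divided difference.\<close>
  define L where "L = (\<Sum>i\<le>m. smult (poly F (u i) / w i) (b i))"
  have "poly L (u j) = poly F (u j)" if "j \<le> m" for j
  proof -
    have "poly L (u j) = (\<Sum>i\<le>m. if i = j then poly F (u j) else 0)"
      unfolding L_def poly_sum using that w0
      by (intro sum.cong) (auto simp: poly_b)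
    then show ?thesis using that by simp
  qed
  moreover have "card (u ` {..m}) = Suc m"
    using inj by (subst card_image) (auto intro!: inj_onI)
  moreover have "degree L < Suc m"
    unfolding L_def less_Suc_eq_le
    by (intro degree_sum_le) (auto intro: order_trans[OF degree_smult_le] simp: deg_b)
  ultimately have "L = F"
    using deg by (intro poly_eqI_degree[of "u ` {..m}"]) auto
  then have "coeff L m = 0"
    using deg by (simp add: coeff_eq_0)
  then have sum0: "(\<Sum>i\<le>m. poly F (u i) / w i) = 0"
    by (simp add: L_def coeff_sum lc_b)
  \<comment> \<open>The nodes decrease, so exactly the \<open>i\<close> factors of
    \<open>w i\<close> with \<open>j < i\<close> are negative.\<close>
  have sign: "(-1) ^ i * w i > 0" if "i \<le> m" for i
  proof -
    have "w i = (\<Prod>j<i. u i - u j) * (\<Prod>j\<in>{i<..m}. u i - u j)"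
      unfolding w_def using that
      by (subst prod.union_disjoint[symmetric]) (auto intro!: prod.cong)
    also have "(\<Prod>j<i. u i - u j) = (-1) ^ i * (\<Prod>j<i. u j - u i)"
      using prod_uminus[of "\<lambda>j. u j - u i" "{..<i}"] by simp
    finally have "(-1) ^ i * w i = (\<Prod>j<i. u j - u i) * (\<Prod>j\<in>{i<..m}. u i - u j)"
      by (simp add: mult.assoc[symmetric] power_add[symmetric])
    also have "\<dots> > 0"
      using that by (intro mult_pos_pos prod_pos) (auto intro: anti)
    finally show ?thesis .
  qed
  have "poly F (u i) / w i \<ge> 0" if "i \<le> m" for i
  proof -
    have "poly F (u i) / w i = ((-1) ^ i * poly F (u i)) / ((-1) ^ i * w i)" by simp
    then show ?thesis using alt[OF that] sign[OF that] by (metis divide_nonneg_pos)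
  qed
  then have "poly F (u 0) / w 0 = 0"
    using sum0 by (subst (asm) sum_nonneg_eq_0_iff) auto
  then show ?thesis using w0[of 0] by simp
qed

section \<open>The substitution u = cot(t/2)\<close>

text \<open>For \<open>degree p \<le> n\<close> this is B^n p(A/B) with the denominators cleared.
  The exponent \<open>n\<close> is a separate argument because it may exceed the degree of
  \<open>p\<close>.\<close>

definition homogenize :: "nat \<Rightarrow> real poly \<Rightarrow> real poly \<Rightarrow> real poly \<Rightarrow> real poly" where
  "homogenize n p A B = (\<Sum>i\<le>n. smult (coeff p i) (A ^ i * B ^ (n - i)))"

lemma degree_homogenize_le:
  assumes "degree A \<le> d" "degree B \<le> d"
  shows "degree (homogenize n p A B) \<le> d * n"
  unfolding homogenize_def
proof (intro degree_sum_le)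
  fix i assume i: "i \<in> {..n}"
  have "degree (A ^ i * B ^ (n - i)) \<le> d * i + d * (n - i)"
    using degree_mult_le[of "A ^ i" "B ^ (n - i)"] degree_power_le[of A i]
      degree_power_le[of B "n - i"] mult_le_mono1[OF assms(1), of i]
      mult_le_mono1[OF assms(2), of "n - i"] by linarith
  also have "\<dots> = d * n" using i by (simp flip: distrib_left)
  finally show "degree (smult (coeff p i) (A ^ i * B ^ (n - i))) \<le> d * n"
    using degree_smult_le order_trans by blast
qed auto

lemma poly_homogenize:
  assumes "degree p \<le> n" "poly B u \<noteq> 0"
  shows "poly (homogenize n p A B) u = poly B u ^ n * poly p (poly A u / poly B u)"
proof -
  have "poly p x = (\<Sum>i\<le>n. coeff p i * x ^ i)" for x
    unfolding poly_altdef using assms(1)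
    by (intro sum.mono_neutral_left) (auto simp: coeff_eq_0)
  then show ?thesis
    using assms(2)
    by (auto simp: homogenize_def poly_sum sum_distrib_left power_diff power_divide intro!: sum.cong)
qed

text \<open>The leading coefficients of p(x) and p(-x) are both nonnegative, while in odd degree
  they are opposite. They would then be zero, which forces p = 0 and degree 0.\<close>

lemma even_degree_if_nonneg:
  fixes p :: "real poly"
  assumes "\<And>x. poly p x \<ge> 0"
  shows "even (degree p)"
proof (rule ccontr)
  assume odd: "odd (degree p)"
  have nonneg_lc: "lead_coeff r \<ge> 0" if "\<And>x. poly r x \<ge> 0" for r :: "real poly"
  proof (rule ccontr)
    assume "\<not> lead_coeff r \<ge> 0"
    then have "lead_coeff (- r) > 0" by (simp add: coeff_minus lead_coeff_minus)
    then obtain n where "\<forall>x\<ge>n. poly (- r) x \<ge> lead_coeff (- r)"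
      using poly_pinfty_gt_lc by blast
    then have "poly (- r) n > 0" using \<open>lead_coeff (- r) > 0\<close> by force
    then show False using that[of n] by simp
  qed
  have "lead_coeff (pcompose p [:0, -1:]) \<ge> 0"
    by (rule nonneg_lc) (simp add: poly_pcompose assms)
  then have "lead_coeff p \<le> 0"
    using odd by (simp add: lead_coeff_comp)
  then show False using nonneg_lc[OF assms] odd by force
qed

text \<open>Bringing the contact point to \<open>t = 0\<close>, i.e. to \<open>cot (t/2) = \<infinity>\<close>, turns the
  double zero of \<open>M - p (cos (\<theta> + t))\<close> into a drop of the degree by two.\<close>

lemma contact_degree_drop:
  fixes p :: "real poly"
  assumes k: "k \<ge> 1" and deg: "degree p \<le> k"
    and le: "\<And>x. \<bar>x\<bar> \<le> 1 \<Longrightarrow> poly p x \<le> M" and contact: "poly p (cos \<theta>) = M"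
  obtains Q where "degree Q \<le> 2 * k - 2"
    and "\<And>t. sin (t / 2) \<noteq> 0 \<Longrightarrow>
      poly Q (cot (t / 2)) = (M - poly p (cos (\<theta> + t))) / sin (t / 2) ^ (2 * k)"
proof -
  \<comment> \<open>At u = cot(t/2) the half-angle formulas give the values cos(theta + t) /
    sin(t/2)^2 for \<open>A\<close> and 1 / sin(t/2)^2 for \<open>B\<close>, so that A/B is
    cos(theta + t).\<close>
  define A where "A = [:- cos \<theta>, - 2 * sin \<theta>, cos \<theta>:]"
  define B where "B = [:1, 0, 1 :: real:]"
  have "poly ([:M:] - p) (cos \<theta>) = 0" using contact by simp
  then obtain s where s: "[:M:] - p = [:- cos \<theta>, 1:] * s"
    unfolding poly_eq_0_iff_dvd by auto
  have deg_s: "degree s \<le> k - 1"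
  proof (cases "s = 0")
    case False
    then have "degree ([:- cos \<theta>, 1:] * s) = Suc (degree s)"
      by (subst degree_mult_eq) auto
    moreover have "degree ([:M:] - p) \<le> k"
      using deg by (intro degree_diff_le) auto
    ultimately show ?thesis using s by simp
  qed simp
  \<comment> \<open>This is B^k (M - p)(A/B) with the factor x - cos(theta) of M - p split off. The
    quadratic terms of the first factor cancel, which lowers the degree bound from 2k to 2k -
    1.\<close>
  define Q where "Q = (A - smult (cos \<theta>) B) * homogenize (k - 1) s A B"
  have "degree (A - smult (cos \<theta>) B) \<le> 1" by (simp add: A_def B_def)
  moreover have "degree (homogenize (k - 1) s A B) \<le> 2 * (k - 1)"
    by (rule degree_homogenize_le) (auto simp: A_def B_def)
  ultimately have degQ: "degree Q \<le> 2 * k - 1"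
    unfolding Q_def
    using degree_mult_le[of "A - smult (cos \<theta>) B" "homogenize (k - 1) s A B"] k by linarith
  have Q: "poly Q (cot (t / 2)) = (M - poly p (cos (\<theta> + t))) / sin (t / 2) ^ (2 * k)"
    if t: "sin (t / 2) \<noteq> 0" for t
  proof -
    let ?u = "cot (t / 2)"
    have B: "poly B ?u = 1 / sin (t / 2) ^ 2"
    proof -
      have "poly B ?u = (sin (t / 2) ^ 2 + cos (t / 2) ^ 2) / sin (t / 2) ^ 2"
        using t by (simp add: B_def cot_def field_simps power2_eq_square)
      then show ?thesis by simp
    qed
    have c: "cos t = cos (t / 2) ^ 2 - sin (t / 2) ^ 2" and d: "sin t = 2 * sin (t / 2) * cos (t / 2)"
      using cos_double[of "t / 2"] sin_double[of "t / 2"] by auto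
    have A: "poly A ?u = cos (\<theta> + t) / sin (t / 2) ^ 2"
      unfolding cos_add c d A_def using t by (simp add: cot_def field_simps power2_eq_square)
    have AB: "poly A ?u / poly B ?u = cos (\<theta> + t)" using t by (simp add: A B)
    have h: "poly (homogenize (k - 1) s A B) ?u =
        (1 / sin (t / 2) ^ 2) ^ (k - 1) * poly s (cos (\<theta> + t))"
      using poly_homogenize[OF deg_s, of B ?u A] t unfolding AB by (simp add: B)
    have "poly Q ?u = (cos (\<theta> + t) - cos \<theta>) / sin (t / 2) ^ 2 *
        (1 / sin (t / 2) ^ 2) ^ (k - 1) * poly s (cos (\<theta> + t))"
      unfolding Q_def poly_mult h by (simp add: A B diff_divide_distrib)
    also have "\<dots> = poly ([:M:] - p) (cos (\<theta> + t)) * ((1 / sin (t / 2) ^ 2) * (1 / sin (t / 2) ^ 2) ^ (k - 1))"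
      unfolding s by (simp add: algebra_simps)
    also have "(1 / sin (t / 2) ^ 2) * (1 / sin (t / 2) ^ 2) ^ (k - 1) = (1 / sin (t / 2) ^ 2) ^ k"
      using k by (metis One_nat_def Suc_pred' le_simps(3) less_eq_Suc_le power_Suc)
    finally show ?thesis by (simp add: power_divide power_mult)
  qed
  \<comment> \<open>The second drop comes from parity: \<open>Q\<close> is nonnegative on the whole
    line, so its degree cannot be the odd number 2k - 1.\<close>
  have "poly Q u \<ge> 0" for u
  proof -
    define t where "t = pi - 2 * arctan u"
    have t2: "t / 2 = pi / 2 - arctan u" by (simp add: t_def field_simps)
    have "cot (t / 2) = u"
      unfolding t2 by (simp add: tan_arctan flip: tan_cot')
    moreover have "sin (t / 2) \<noteq> 0"
      unfolding t2 by (simp add: sin_diff)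
    ultimately show ?thesis
      using Q[of t] le[of "cos (\<theta> + t)"] by (simp add: power_mult)
  qed
  then have "degree Q \<noteq> 2 * k - 1"
    using even_degree_if_nonneg[of Q] k by auto
  then show ?thesis using that[of Q] degQ Q by auto
qed

section \<open>Riesz's comparison with M cos(kt)\<close>

lemma cot_less_cot:
  fixes a b :: real
  assumes "0 < a" "a < b" "b < pi"
  shows "cot b < cot a"
proof -
  have pos: "sin a > 0" "sin b > 0" "sin (b - a) > 0"
    using assms by (auto intro!: sin_gt_zero)
  then have "cot a - cot b = sin (b - a) / (sin a * sin b)"
    by (simp add: cot_def sin_diff field_simps)
  also have "\<dots> > 0" using pos by simp
  finally show ?thesis by simp
qed

lemma poly_cos_ge_near_max:
  fixes p :: "real poly"
  assumes k: "k \<ge> 1" and deg: "degree p \<le> k"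
    and bound: "\<And>x. \<bar>x\<bar> \<le> 1 \<Longrightarrow> \<bar>poly p x\<bar> \<le> M" and contact: "poly p (cos \<theta>) = M"
    and \<phi>: "0 < \<phi>" "\<phi> < pi / k"
  shows "poly p (cos (\<theta> + \<phi>)) \<ge> M * cos (k * \<phi>)"
proof (rule ccontr)
  assume less: "\<not> ?thesis"
  have M: "M \<ge> 0" using bound[of 0] by simp
  obtain T :: "real poly" where T: "degree T \<le> k" "\<And>t. poly T (cos t) = cos (real k * t)"
    using Chebyshev_poly_exists by blast
  obtain Q where Q: "degree Q \<le> 2 * k - 2" "\<And>t. sin (t / 2) \<noteq> 0 \<Longrightarrow>
      poly Q (cot (t / 2)) = (M - poly p (cos (\<theta> + t))) / sin (t / 2) ^ (2 * k)"
    using contact_degree_drop[OF k deg _ contact] bound abs_le_D1 by metis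
  \<comment> \<open>The function M cos(kt) has its own contact with M at t = 0, so the same degree
    drop applies to it, and \<open>Q - R\<close> has degree at most 2k - 2.\<close>
  have "poly (smult M T) x \<le> M" if "\<bar>x\<bar> \<le> 1" for x
  proof -
    have "poly T x \<le> 1" using T(2)[of "arccos x"] that by (simp add: abs_le_iff)
    then show ?thesis using M by (simp add: mult_left_le)
  qed
  moreover have "poly (smult M T) (cos 0) = M" using T(2)[of 0] by simp
  moreover have "degree (smult M T) \<le> k" using T(1) by simp
  ultimately obtain R where R: "degree R \<le> 2 * k - 2" "\<And>t. sin (t / 2) \<noteq> 0 \<Longrightarrow>
      poly R (cot (t / 2)) = (M - poly (smult M T) (cos (0 + t))) / sin (t / 2) ^ (2 * k)"
    using contact_degree_drop[OF k] by metis
  have F: "poly (Q - R) (cot (t / 2)) = (M * cos (k * t) - poly p (cos (\<theta> + t))) / sin (t / 2) ^ (2 * k)"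
    if "sin (t / 2) \<noteq> 0" for t :: real
    using Q(2)[OF that] R(2)[OF that] by (simp add: T(2) diff_divide_distrib)
  \<comment> \<open>For i > 0 these are the extrema of cos(kt) in (0, 2 pi), with values (-1)^i. The
    point \<open>\<phi>\<close>, where the difference is strictly positive by assumption, precedes
    them. These 2k points correspond to m = 2k - 1, just above the degree.\<close>
  define t where "t i = (if i = 0 then \<phi> else i * pi / k)" for i :: nat
  have t_mono: "t i < t j" if "i < j" for i j
  proof (cases "i = 0")
    case True
    have "pi / k \<le> j * pi / k" using that k by (intro divide_right_mono) auto
    then show ?thesis using True that \<phi> by (simp add: t_def)
  next
    case False
    then show ?thesis using that k by (simp add: t_def divide_strict_right_mono)
  qed
  have t_range: "0 < t i / 2" "t i / 2 < pi" if "i \<le> 2 * k - 1" for i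
  proof -
    have "t 0 > 0" using \<phi> by (simp add: t_def)
    then show "0 < t i / 2" using t_mono[of 0 i] by (cases "i = 0") auto
    have "t i < t (2 * k)" using that k by (intro t_mono) auto
    also have "\<dots> = 2 * pi" using k by (simp add: t_def)
    finally show "t i / 2 < pi" by simp
  qed
  have sin_t: "sin (t i / 2) > 0" if "i \<le> 2 * k - 1" for i
    using t_range[OF that] by (rule sin_gt_zero)
  have "poly (Q - R) (cot (t 0 / 2)) = 0"
  proof (rule alternating_signs_imp_root[where m = "2 * k - 1"])
    show "degree (Q - R) < 2 * k - 1"
      using degree_diff_le[OF Q(1) R(1)] k by linarith
    show "cot (t j / 2) < cot (t i / 2)" if "i < j" "j \<le> 2 * k - 1" for i j
      using that t_range(1)[of i] t_range(2)[of j] t_mono[of i j] by (intro cot_less_cot) auto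
    show "(- 1) ^ i * poly (Q - R) (cot (t i / 2)) \<ge> 0" if i: "i \<le> 2 * k - 1" for i
    proof (cases "i = 0")
      case True
      then show ?thesis using F[of "t 0"] sin_t[of 0] less by (simp add: t_def)
    next
      case False
      have "cos (k * t i) = (-1) ^ i"
        using False k by (simp add: t_def cos_npi)
      then have "(- 1) ^ i * poly (Q - R) (cot (t i / 2)) =
          (M - (- 1) ^ i * poly p (cos (\<theta> + t i))) / sin (t i / 2) ^ (2 * k)"
        using F[of "t i"] sin_t[OF i] by (simp add: algebra_simps)
      moreover have "(- 1) ^ i * poly p (cos (\<theta> + t i)) \<le> M"
        using bound[of "cos (\<theta> + t i)"] by (cases "even i") auto
      ultimately show ?thesis by (simp add: power_mult)
    qed
  qed
  then show False
    using F[of "t 0"] sin_t[of 0] less by (simp add: t_def)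
qed

section \<open>From angles to distances in [-1,1]\<close>

lemma abs_sin_nat_mult_le: "\<bar>sin (real n * x)\<bar> \<le> real n * \<bar>sin x\<bar>"
proof (induction n)
  case (Suc n)
  have "sin (real (Suc n) * x) = sin (real n * x) * cos x + cos (real n * x) * sin x"
    by (simp add: distrib_right sin_add add.commute)
  then have "\<bar>sin (real (Suc n) * x)\<bar> \<le> \<bar>sin (real n * x)\<bar> * \<bar>cos x\<bar> + \<bar>cos (real n * x)\<bar> * \<bar>sin x\<bar>"
    by (metis abs_mult abs_triangle_ineq)
  also have "\<dots> \<le> \<bar>sin (real n * x)\<bar> + \<bar>sin x\<bar>"
    by (intro add_mono mult_left_le mult_left_le_one_le) auto
  finally show ?case using Suc.IH by (simp add: algebra_simps)
qed simp

lemma one_minus_cos_eq: "1 - cos x = 2 * (sin (x / 2))\<^sup>2" for x :: real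
  using cos_double_sin[of "x / 2"] by simp

text \<open>This is the source of the factor k^2: at half the angle it is the square of
  \<open>abs_sin_nat_mult_le\<close>.\<close>

lemma one_minus_cos_nat_mult_le: "1 - cos (real n * x) \<le> (real n)\<^sup>2 * (1 - cos x)"
proof -
  have "\<bar>sin (real n * (x / 2))\<bar>\<^sup>2 \<le> (real n * \<bar>sin (x / 2)\<bar>)\<^sup>2"
    by (intro power_mono abs_sin_nat_mult_le) simp
  then show ?thesis unfolding one_minus_cos_eq by (simp add: power_mult_distrib)
qed

text \<open>Both sides contain the factor 2 sin((b - a)/2); what remains to compare is sin((b -
  a)/2) with sin((a + b)/2). It lets the distance of two points of [-1,1] control the angle between
  them.\<close>

lemma one_minus_cos_diff_le:
  fixes a b :: real
  assumes "0 \<le> a" "a \<le> b" "b \<le> pi"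
  shows "1 - cos (b - a) \<le> cos a - cos b"
proof -
  have "sin ((b - a) / 2) \<le> sin ((a + b) / 2)"
  proof -
    have "sin ((a + b) / 2) - sin ((b - a) / 2) = 2 * (sin (a / 2) * cos (b / 2))"
      by (simp add: add_divide_distrib diff_divide_distrib sin_add sin_diff)
    also have "\<dots> \<ge> 0"
      using assms by (intro mult_nonneg_nonneg sin_ge_zero cos_ge_zero) auto
    finally show ?thesis by simp
  qed
  moreover have "sin ((b - a) / 2) \<ge> 0"
    using assms by (intro sin_ge_zero) auto
  ultimately have "sin ((b - a) / 2) * sin ((b - a) / 2) \<le> sin ((a + b) / 2) * sin ((b - a) / 2)"
    by (rule mult_right_mono)
  then show ?thesis
    unfolding cos_diff_cos one_minus_cos_eq by (simp add: power2_eq_square)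
qed

text \<open>If phi is the angle between the two points, then cos(k phi) is at least 1 - k^2 (1 -
  cos(phi)), which is at least 1 - k^2 |x - y|.\<close>

lemma poly_ge_near_max:
  fixes p :: "real poly"
  assumes k: "k \<ge> 1" and deg: "degree p \<le> k"
    and bound: "\<And>x. \<bar>x\<bar> \<le> 1 \<Longrightarrow> \<bar>poly p x\<bar> \<le> M"
    and y: "\<bar>y\<bar> \<le> 1" "\<bar>poly p y\<bar> = M" and x: "\<bar>x\<bar> \<le> 1" "(real k)\<^sup>2 * \<bar>x - y\<bar> \<le> 1"
  shows "\<bar>poly p x\<bar> \<ge> M * (1 - (real k)\<^sup>2 * \<bar>x - y\<bar>)"
proof -
  have M: "M \<ge> 0" using bound[of 0] by simp
  have main: "poly r x \<ge> M * (1 - (real k)\<^sup>2 * \<bar>x - y\<bar>)"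
    if r: "degree r \<le> k" "\<And>x. \<bar>x\<bar> \<le> 1 \<Longrightarrow> \<bar>poly r x\<bar> \<le> M" "poly r y = M" for r
  proof -
    define \<phi> where "\<phi> = \<bar>arccos x - arccos y\<bar>"
    \<comment> \<open>The sign makes \<open>\<theta> + \<phi>\<close> equal to
      \<open>arccos x\<close> or its negative, so the bound for positive \<open>\<phi>\<close>
      serves both sides of \<open>y\<close>.\<close>
    define \<theta> where "\<theta> = (if arccos y \<le> arccos x then arccos y else - arccos y)"
    have xy: "cos \<theta> = y" "cos (\<theta> + \<phi>) = x"
      using x(1) y(1) by (auto simp: \<theta>_def \<phi>_def cos_arccos_abs)
    have range: "arccos x \<in> {0..pi}" "arccos y \<in> {0..pi}"
      using x(1) y(1) by (auto simp: abs_le_iff arccos_lbound arccos_ubound)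
    have "1 - cos \<phi> \<le> \<bar>x - y\<bar>"
      using one_minus_cos_diff_le[of "arccos x" "arccos y"]
        one_minus_cos_diff_le[of "arccos y" "arccos x"] range x(1) y(1)
      by (cases "arccos y \<le> arccos x") (auto simp: \<phi>_def cos_arccos_abs)
    then have dist: "(real k)\<^sup>2 * (1 - cos \<phi>) \<le> (real k)\<^sup>2 * \<bar>x - y\<bar>"
      by (rule mult_left_mono) simp
    show ?thesis
    proof (cases "\<phi> = 0")
      case True
      then show ?thesis using xy r(3) M by auto
    next
      case False
      \<comment> \<open>Otherwise k^2 |x - y| would be at least k^2 (1 - cos(pi/k)), hence at least
        1 - cos(pi) = 2.\<close>
      have small: "\<phi> < pi / k"
      proof (rule ccontr)
        assume "\<not> \<phi> < pi / k"
        then have "cos \<phi> \<le> cos (pi / k)"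
          using range k by (intro cos_monotone_0_pi_le) (auto simp: \<phi>_def)
        then have "(real k)\<^sup>2 * (1 - cos (pi / k)) \<le> (real k)\<^sup>2 * (1 - cos \<phi>)"
          by (intro mult_left_mono) auto
        moreover have "2 \<le> (real k)\<^sup>2 * (1 - cos (pi / k))"
          using one_minus_cos_nat_mult_le[of k "pi / k"] k by simp
        ultimately show False
          using dist x(2) by linarith
      qed
      have "1 - (real k)\<^sup>2 * \<bar>x - y\<bar> \<le> cos (k * \<phi>)"
        using one_minus_cos_nat_mult_le[of k \<phi>] dist by simp
      then have "M * (1 - (real k)\<^sup>2 * \<bar>x - y\<bar>) \<le> M * cos (k * \<phi>)"
        using M by (rule mult_left_mono)
      also have "\<dots> \<le> poly r x"
        using poly_cos_ge_near_max[OF k r(1) r(2), of \<theta> \<phi>] xy r(3) small False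
        by (simp add: \<phi>_def)
      finally show ?thesis .
    qed
  qed
  show ?thesis
  proof (cases "poly p y = M")
    case True
    then show ?thesis using main[of p] deg bound by fastforce
  next
    case False
    then have "poly (- p) y = M" using y(2) by auto
    then show ?thesis using main[of "- p"] deg bound by fastforce
  qed
qed

section \<open>The one-dimensional integral estimate\<close>

lemma nn_integral_powr_Icc01:
  fixes q :: real
  assumes "q > 0"
  shows "(\<integral>\<^sup>+x. ennreal (x powr q) * indicator {0..1} x \<partial>lborel) = ennreal (1 / (q + 1))"
proof -
  have "((\<lambda>x. x powr q) has_integral (1 / (q + 1))) {0..1}"
    using has_integral_powr_from_0[of q 1] assms by simp
  then have "((\<lambda>x. x powr q * indicator {0..1} x) has_integral (1 / (q + 1))) UNIV"
    by (subst (asm) has_integral_restrict_UNIV[symmetric])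
      (auto simp: indicator_def of_bool_def if_distrib cong: if_cong)
  then have "(\<integral>\<^sup>+x. ennreal (x powr q * indicator {0..1} x) \<partial>lborel) = ennreal (1 / (q + 1))"
    by (intro nn_integral_has_integral_lborel) auto
  then show ?thesis
    by (simp add: ennreal_mult' ennreal_indicator)
qed

lemma poly_powr_le_nn_integral:
  fixes p :: "real poly" and q :: real
  assumes k: "k \<ge> 1" and deg: "degree p \<le> k" and q: "q > 0" and x: "\<bar>x\<bar> \<le> 1"
  shows "ennreal (\<bar>poly p x\<bar> powr q) \<le> ennreal ((q + 1) * (real k)\<^sup>2) *
    (\<integral>\<^sup>+s. ennreal (\<bar>poly p s\<bar> powr q) * indicator {-1..1} s \<partial>lborel)"
proof -
  have "compact {-1..1 :: real}" "{-1..1 :: real} \<noteq> {}" "continuous_on {-1..1} (\<lambda>x. \<bar>poly p x\<bar>)"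
    by (auto intro!: continuous_intros)
  from continuous_attains_sup[OF this] obtain y where y: "\<bar>y\<bar> \<le> 1"
    and max: "\<And>z. \<bar>z\<bar> \<le> 1 \<Longrightarrow> \<bar>poly p z\<bar> \<le> \<bar>poly p y\<bar>"
    by (auto simp: abs_le_iff)
  define M where "M = \<bar>poly p y\<bar>"
  define K where "K = (real k)\<^sup>2"
  have K: "K \<ge> 1" using k by (simp add: K_def)
  \<comment> \<open>The direction from \<open>y\<close> towards the far endpoint. As 1/K is at most
    1, the interval of length 1/K on that side of \<open>y\<close> lies in [-1,1].\<close>
  define \<sigma> :: real where "\<sigma> = (if y \<le> 0 then 1 else - 1)"
  define g where "g s = ennreal (\<bar>poly p s\<bar> powr q) * indicator {-1..1} s" for s
  have [measurable]: "g \<in> borel_measurable borel"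
  proof -
    have [measurable]: "poly p \<in> borel_measurable borel"
      by (intro borel_measurable_continuous_onI continuous_intros)
    show ?thesis unfolding g_def by measurable
  qed
  \<comment> \<open>The affine map puts the new point at distance (1 - s)/K from \<open>y\<close>,
    so the linear lower bound of \<open>poly_ge_near_max\<close> becomes
    \<open>M * s\<close>.\<close>
  have lower: "ennreal (M powr q) * (ennreal (s powr q) * indicator {0..1} s)
      \<le> g ((y + \<sigma> / K) + (- \<sigma> / K) * s)" for s
  proof (cases "s \<in> {0..1}")
    case True
    define z where "z = (y + \<sigma> / K) + (- \<sigma> / K) * s"
    define w where "w = (1 - s) / K"
    have z: "z - y = \<sigma> * w" by (simp add: z_def w_def diff_divide_distrib algebra_simps)
    have dist: "0 \<le> w" "w \<le> 1"
      using True K by (auto simp: w_def divide_le_eq)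
    have abs: "K * \<bar>z - y\<bar> = 1 - s"
      unfolding z using dist K True by (auto simp: \<sigma>_def abs_mult w_def)
    have z1: "\<bar>z\<bar> \<le> 1"
      using z dist y by (auto simp: \<sigma>_def abs_le_iff split: if_splits)
    have "M * (1 - K * \<bar>z - y\<bar>) \<le> \<bar>poly p z\<bar>"
      unfolding K_def using k deg y max z1 abs True
      by (intro poly_ge_near_max) (auto simp: M_def K_def)
    then have "M * s \<le> \<bar>poly p z\<bar>" unfolding abs by simp
    then have "(M * s) powr q \<le> \<bar>poly p z\<bar> powr q"
      using True q by (intro powr_mono2) (auto simp: M_def)
    then have "ennreal (M powr q) * ennreal (s powr q) \<le> ennreal (\<bar>poly p z\<bar> powr q)"
      using True by (simp add: ennreal_mult'[symmetric] powr_mult M_def)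
    then show ?thesis using True z1 unfolding z_def[symmetric] g_def by (simp add: abs_le_iff)
  qed simp
  have "ennreal (M powr q) * ennreal (1 / (q + 1)) =
      (\<integral>\<^sup>+s. ennreal (M powr q) * (ennreal (s powr q) * indicator {0..1} s) \<partial>lborel)"
    using q by (subst nn_integral_cmult) (auto simp: nn_integral_powr_Icc01)
  also have "\<dots> \<le> (\<integral>\<^sup>+s. g ((y + \<sigma> / K) + (- \<sigma> / K) * s) \<partial>lborel)"
    by (intro nn_integral_mono lower)
  finally have 1: "ennreal (M powr q) * ennreal (1 / (q + 1)) \<le> \<dots>" .
  have 2: "(\<integral>\<^sup>+s. g s \<partial>lborel) = ennreal (1 / K) * (\<integral>\<^sup>+s. g ((y + \<sigma> / K) + (- \<sigma> / K) * s) \<partial>lborel)"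
    using K by (subst nn_integral_real_affine[of g "- \<sigma> / K" "y + \<sigma> / K"]) (auto simp: \<sigma>_def)
  have "ennreal (M powr q) = ennreal ((q + 1) * K) * (ennreal (1 / K) * (ennreal (M powr q) * ennreal (1 / (q + 1))))"
    using q K by (simp add: ennreal_mult'[symmetric])
  also have "\<dots> \<le> ennreal ((q + 1) * K) * (\<integral>\<^sup>+s. g s \<partial>lborel)"
    unfolding 2 by (intro mult_left_mono 1) auto
  finally have "ennreal (M powr q) \<le> ennreal ((q + 1) * K) * (\<integral>\<^sup>+s. g s \<partial>lborel)" .
  moreover have "ennreal (\<bar>poly p x\<bar> powr q) \<le> ennreal (M powr q)"
    using max[OF x] q by (intro ennreal_leI powr_mono2) (auto simp: M_def)
  ultimately show ?thesis unfolding g_def K_def by (rule order_trans[rotated])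
qed

section \<open>Several variables, one coordinate at a time\<close>

text \<open>The coordinates in \<open>I\<close> are integrated over [-1,1] while the others stay
  frozen at \<open>y\<close>. Each inserted coordinate costs one factor of the one-dimensional
  constant. With nonnegative integrals the iteration needs measurability only.\<close>

lemma powr_le_nn_integral_coordinates:
  fixes v :: "'a :: euclidean_space \<Rightarrow> real" and q :: real
  assumes k: "k \<ge> 1" and q: "q > 0" and cont: "continuous_on UNIV v"
    and poly: "\<And>x b. b \<in> Basis \<Longrightarrow> \<exists>p. degree p \<le> k \<and> (\<forall>s. v (x + s *\<^sub>R b) = poly p s)"
    and I: "I \<subseteq> Basis" and y: "\<And>b. b \<in> I \<Longrightarrow> \<bar>y b\<bar> \<le> 1"
  shows "ennreal (\<bar>v (\<Sum>b\<in>Basis. y b *\<^sub>R b)\<bar> powr q) \<le> ennreal ((q + 1) * (real k)\<^sup>2) ^ card I *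
    (\<integral>\<^sup>+z. (\<Prod>b\<in>I. indicator {-1..1} (z b)) *
      ennreal (\<bar>v (\<Sum>b\<in>Basis. (if b \<in> I then z b else y b) *\<^sub>R b)\<bar> powr q) \<partial>(\<Pi>\<^sub>M b\<in>I. lborel))"
  using finite_subset[OF I finite_Basis] I y
proof (induction I rule: finite_induct)
  case empty
  interpret product_sigma_finite "\<lambda>_. lborel :: real measure" by unfold_locales
  show ?case by (subst nn_integral_empty) auto
next
  case (insert i J)
  interpret product_sigma_finite "\<lambda>_. lborel :: real measure" by unfold_locales
  have [measurable]: "v \<in> borel_measurable borel"
    using cont by (rule borel_measurable_continuous_onI)
  let ?C = "ennreal ((q + 1) * (real k)\<^sup>2)"
  let ?v = "\<lambda>z. ennreal (\<bar>v (\<Sum>b\<in>Basis. z b *\<^sub>R b)\<bar> powr q)"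
  let ?m = "\<lambda>I z b. if b \<in> I then z b else y b"
  let ?P = "\<lambda>I z. (\<Prod>b\<in>I. indicator {-1..1 :: real} (z b)) :: ennreal"
  have meas: "(\<lambda>z. ?P I z * ?v (?m I z)) \<in> borel_measurable (\<Pi>\<^sub>M b\<in>I. lborel)" for I
  proof -
    have "(\<lambda>z. ?m I z b) \<in> borel_measurable (\<Pi>\<^sub>M b\<in>I. lborel)" for b
      by (cases "b \<in> I") (auto intro: measurable_component_singleton)
    note [measurable] = this
    show ?thesis by measurable
  qed
  \<comment> \<open>With all coordinates but \<open>i\<close> frozen, \<open>v\<close> is a
    polynomial of degree at most \<open>k\<close> in one variable.\<close>
  have step: "?v (?m J z) \<le> ?C * (\<integral>\<^sup>+s. indicator {-1..1} s * ?v (?m (insert i J) (z(i := s))) \<partial>lborel)" for z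
  proof -
    define x where "x = (\<Sum>b\<in>Basis - {i}. ?m J z b *\<^sub>R b)"
    have i: "i \<in> Basis" using insert.prems by simp
    obtain p where p: "degree p \<le> k" "\<And>s. v (x + s *\<^sub>R i) = poly p s"
      using poly[OF i] by metis
    have "(\<Sum>b\<in>Basis. ?m J z b *\<^sub>R b) = x + y i *\<^sub>R i"
      unfolding x_def using i insert.hyps by (subst sum.remove[of _ i]) (auto simp: add.commute)
    moreover have "(\<Sum>b\<in>Basis. ?m (insert i J) (z(i := s)) b *\<^sub>R b) = x + s *\<^sub>R i" for s
    proof -
      have "(\<Sum>b\<in>Basis - {i}. ?m (insert i J) (z(i := s)) b *\<^sub>R b) = x"
        unfolding x_def by (intro sum.cong) auto
      then show ?thesis using i by (subst sum.remove[of _ i]) (auto simp: add.commute)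
    qed
    ultimately show ?thesis
      using poly_powr_le_nn_integral[OF k p(1) q, of "y i"] insert.prems(2)[of i]
      by (simp add: p(2) mult.commute)
  qed
  have "?v y \<le> ?C ^ card J * (\<integral>\<^sup>+z. ?P J z * ?v (?m J z) \<partial>(\<Pi>\<^sub>M b\<in>J. lborel))"
    using insert by auto
  also have "\<dots> \<le> ?C ^ card J * (\<integral>\<^sup>+z. ?C * (\<integral>\<^sup>+s. ?P (insert i J) (z(i := s)) *
      ?v (?m (insert i J) (z(i := s))) \<partial>lborel) \<partial>(\<Pi>\<^sub>M b\<in>J. lborel))"
  proof (intro mult_left_mono nn_integral_mono)
    fix z
    have P: "?P (insert i J) (z(i := s)) = ?P J z * indicator {-1..1} s" for s
    proof -
      have "?P J (z(i := s)) = ?P J z" using insert.hyps by (intro prod.cong) auto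
      then show ?thesis using insert.hyps by (simp add: mult.commute)
    qed
    have "?P J z * ?v (?m J z) \<le> ?P J z * (?C * (\<integral>\<^sup>+s. indicator {-1..1} s * ?v (?m (insert i J) (z(i := s))) \<partial>lborel))"
      by (intro mult_left_mono step) auto
    also have "\<dots> = ?C * (?P J z * (\<integral>\<^sup>+s. indicator {-1..1} s * ?v (?m (insert i J) (z(i := s))) \<partial>lborel))"
      by (simp add: ac_simps)
    also have "?P J z * (\<integral>\<^sup>+s. indicator {-1..1} s * ?v (?m (insert i J) (z(i := s))) \<partial>lborel) =
        (\<integral>\<^sup>+s. ?P J z * (indicator {-1..1} s * ?v (?m (insert i J) (z(i := s)))) \<partial>lborel)"
    proof (rule nn_integral_cmult[symmetric])
      have "(\<lambda>s. ?m (insert i J) (z(i := s)) b) \<in> borel_measurable lborel" for b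
        by (cases "b = i"; cases "b \<in> J") auto
      note [measurable] = this
      show "(\<lambda>s. indicator {-1..1} s * ?v (?m (insert i J) (z(i := s)))) \<in> borel_measurable lborel"
        by measurable
    qed
    finally show "?P J z * ?v (?m J z) \<le> ?C * (\<integral>\<^sup>+s. ?P (insert i J) (z(i := s)) *
        ?v (?m (insert i J) (z(i := s))) \<partial>lborel)"
      unfolding P by (simp add: mult.assoc)
  qed auto
  also have "\<dots> = ?C ^ card J * (?C * (\<integral>\<^sup>+z. (\<integral>\<^sup>+s. ?P (insert i J) (z(i := s)) *
      ?v (?m (insert i J) (z(i := s))) \<partial>lborel) \<partial>(\<Pi>\<^sub>M b\<in>J. lborel)))"
  proof (intro arg_cong[where f = "(*) (?C ^ card J)"] nn_integral_cmult)
    show "(\<lambda>z. \<integral>\<^sup>+s. ?P (insert i J) (z(i := s)) * ?v (?m (insert i J) (z(i := s))) \<partial>lborel)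
        \<in> borel_measurable (\<Pi>\<^sub>M b\<in>J. lborel)"
    \<comment> \<open>The inner integral is measurable in \<open>z\<close> because its integrand is
      jointly measurable in \<open>z\<close> and \<open>s\<close>.\<close>
    proof (rule lborel.borel_measurable_nn_integral)
      have "(\<lambda>(z, s). z(i := s)) \<in> measurable ((\<Pi>\<^sub>M b\<in>J. lborel) \<Otimes>\<^sub>M lborel) (\<Pi>\<^sub>M b\<in>insert i J. lborel)"
        by (rule measurable_add_dim)
      from measurable_compose[OF this meas[of "insert i J"]]
      show "(\<lambda>(z, s). ?P (insert i J) (z(i := s)) * ?v (?m (insert i J) (z(i := s))))
          \<in> borel_measurable ((\<Pi>\<^sub>M b\<in>J. lborel) \<Otimes>\<^sub>M lborel)"
        unfolding case_prod_unfold .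
    qed
  qed
  also have "\<dots> = ?C ^ card (insert i J) *
      (\<integral>\<^sup>+z. ?P (insert i J) z * ?v (?m (insert i J) z) \<partial>(\<Pi>\<^sub>M b\<in>insert i J. lborel))"
    using insert.hyps by (subst product_nn_integral_insert[OF _ _ meas]) (auto simp: mult_ac)
  finally show ?case .
qed

lemma powr_le_nn_integral_cube:
  fixes v :: "'a :: euclidean_space \<Rightarrow> real" and q :: real
  assumes k: "k \<ge> 1" and q: "q > 0" and cont: "continuous_on UNIV v"
    and poly: "\<And>x b. b \<in> Basis \<Longrightarrow> \<exists>p. degree p \<le> k \<and> (\<forall>s. v (x + s *\<^sub>R b) = poly p s)"
    and x: "x \<in> cbox (- One) One"
  shows "ennreal (\<bar>v x\<bar> powr q) \<le> ennreal ((q + 1) * (real k)\<^sup>2) ^ DIM('a) *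
    (\<integral>\<^sup>+z. ennreal (\<bar>v z\<bar> powr q) * indicator (cbox (- One) One) z \<partial>lborel)"
proof -
  have [measurable]: "v \<in> borel_measurable borel"
    using cont by (rule borel_measurable_continuous_onI)
  let ?s = "\<lambda>z. \<Sum>b\<in>Basis. z b *\<^sub>R b :: 'a"
  have ind: "indicator (cbox (- One) One) (?s z) = (\<Prod>b\<in>Basis. indicator {-1..1} (z b) :: ennreal)"
    for z :: "'a \<Rightarrow> real"
    by (auto simp: indicator_def mem_box of_bool_def prod_zero_iff split: if_splits)
  have "ennreal (\<bar>v x\<bar> powr q) \<le> ennreal ((q + 1) * (real k)\<^sup>2) ^ DIM('a) *
      (\<integral>\<^sup>+z. (\<Prod>b\<in>Basis. indicator {-1..1} (z b)) *
        ennreal (\<bar>v (\<Sum>b\<in>Basis. (if b \<in> Basis then z b else x \<bullet> b) *\<^sub>R b)\<bar> powr q) \<partial>(\<Pi>\<^sub>M b\<in>Basis. lborel))"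
    using powr_le_nn_integral_coordinates[OF k q cont poly, of Basis "\<lambda>b. x \<bullet> b"] x
    by (auto simp: mem_box abs_le_iff euclidean_representation)
  also have "(\<integral>\<^sup>+z. (\<Prod>b\<in>Basis. indicator {-1..1} (z b)) *
        ennreal (\<bar>v (\<Sum>b\<in>Basis. (if b \<in> Basis then z b else x \<bullet> b) *\<^sub>R b)\<bar> powr q) \<partial>(\<Pi>\<^sub>M b\<in>Basis. lborel)) =
      (\<integral>\<^sup>+z. ennreal (\<bar>v (?s z)\<bar> powr q) * indicator (cbox (- One) One) (?s z) \<partial>(\<Pi>\<^sub>M b\<in>Basis. lborel))"
    unfolding ind by (simp add: mult.commute)
  \<comment> \<open>Lebesgue measure is the image of the product measure under the map from
    coordinates to vectors.\<close>
  also have "\<dots> = (\<integral>\<^sup>+z. ennreal (\<bar>v z\<bar> powr q) * indicator (cbox (- One) One) z \<partial>lborel)"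
    unfolding lborel_eq[where 'a = 'a] by (subst nn_integral_distr) auto
  finally show ?thesis .
qed

section \<open>Specialization to Qk on the reference cube\<close>

lemma ref_cube_eq: "(ref_cube :: (real ^ 'n) set) = cbox (- One) One"
proof -
  have "x \<in> ref_cube \<longleftrightarrow> (\<forall>b\<in>Basis. - 1 \<le> x \<bullet> b \<and> x \<bullet> b \<le> 1)" for x :: "real ^ 'n"
    by (auto simp: ref_cube_def mem_box_cart Basis_vec_def inner_axis)
  then show ?thesis by (auto simp: mem_box)
qed

lemma Qk_continuous:
  assumes "v \<in> Qk k"
  shows "continuous_on A v"
  using assms by (auto simp: Qk_iff monomial_def intro!: continuous_intros)

text \<open>Moving along axis \<open>j\<close> changes only coordinate \<open>j\<close>, so each
  monomial becomes a constant times a power of x_j + s, whose exponent is at most \<open>k\<close>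
  because the degree is bounded in each variable separately.\<close>

lemma Qk_line_poly:
  fixes v :: "real ^ 'n \<Rightarrow> real"
  assumes v: "v \<in> Qk k" and b: "b \<in> Basis"
  shows "\<exists>p. degree p \<le> k \<and> (\<forall>s. v (x + s *\<^sub>R b) = poly p s)"
proof -
  obtain j where b: "b = axis j 1" using b by (auto simp: Basis_vec_def)
  obtain S c where S: "finite S" "\<And>\<alpha> i. \<alpha> \<in> S \<Longrightarrow> \<alpha> $ i \<le> k"
    and v: "v = (\<lambda>x. \<Sum>\<alpha>\<in>S. c \<alpha> * monomial \<alpha> x)"
    using v by (auto simp: Qk_iff)
  define m where "m \<alpha> = (\<Prod>i\<in>UNIV. [:x $ i, if i = j then 1 else 0:] ^ (\<alpha> $ i))" for \<alpha> :: "nat ^ 'n"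
  define p where "p = (\<Sum>\<alpha>\<in>S. smult (c \<alpha>) (m \<alpha>))"
  have "degree (m \<alpha>) \<le> k" if "\<alpha> \<in> S" for \<alpha>
  proof -
    have "degree (m \<alpha>) \<le> (\<Sum>i\<in>UNIV. degree ([:x $ i, if i = j then 1 else 0:] ^ (\<alpha> $ i)))"
      unfolding m_def by (rule order_trans[OF degree_prod_sum_le]) (auto simp: o_def)
    also have "\<dots> \<le> (\<Sum>i\<in>UNIV. if i = j then \<alpha> $ j else 0)"
      by (intro sum_mono order_trans[OF degree_power_le]) auto
    also have "\<dots> \<le> k" using S(2)[OF that] by simp
    finally show ?thesis .
  qed
  then have "degree p \<le> k"
    unfolding p_def using S(1)
    by (intro degree_sum_le) (auto intro: order_trans[OF degree_smult_le])
  moreover have "v (x + s *\<^sub>R b) = poly p s" for s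
    unfolding v p_def monomial_def m_def b
    by (auto simp: poly_sum poly_prod axis_def algebra_simps intro!: sum.cong prod.cong)
  ultimately show ?thesis by blast
qed

lemma continuous_on_abs_powr:
  fixes v :: "'a :: topological_space \<Rightarrow> real"
  assumes "continuous_on A v" "r > 0"
  shows "continuous_on A (\<lambda>x. \<bar>v x\<bar> powr r)"
  using assms by (intro continuous_on_powr' continuous_intros) auto

lemma set_integrable_ref_cube:
  fixes f :: "real ^ 'n \<Rightarrow> real"
  assumes "continuous_on UNIV f"
  shows "set_integrable lborel ref_cube f"
  unfolding set_integrable_def ref_cube_def
  using assms by (intro borel_integrable_compact compact_cbox) (auto intro: continuous_on_subset)

lemma Qk_powr_le_integral:
  fixes v :: "real ^ 'n \<Rightarrow> real"
  assumes k: "k \<ge> 1" and q: "q > 0" and v: "v \<in> Qk k" and x: "x \<in> ref_cube"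
  shows "\<bar>v x\<bar> powr q \<le> ((q + 1) * (real k)\<^sup>2) ^ CARD('n) * (LINT z:ref_cube|lborel. \<bar>v z\<bar> powr q)"
proof -
  have int: "integrable lborel (\<lambda>z. indicator ref_cube z *\<^sub>R \<bar>v z\<bar> powr q)"
    using set_integrable_ref_cube[OF continuous_on_abs_powr[OF Qk_continuous[OF v] q]]
    by (simp add: set_integrable_def)
  have "ennreal (\<bar>v x\<bar> powr q) \<le> ennreal ((q + 1) * (real k)\<^sup>2) ^ CARD('n) *
      (\<integral>\<^sup>+z. ennreal (\<bar>v z\<bar> powr q) * indicator ref_cube z \<partial>lborel)"
    using powr_le_nn_integral_cube[OF k q Qk_continuous[OF v] Qk_line_poly[OF v]] x
    by (simp add: ref_cube_eq)
  also have "(\<integral>\<^sup>+z. ennreal (\<bar>v z\<bar> powr q) * indicator ref_cube z \<partial>lborel) =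
      (\<integral>\<^sup>+z. ennreal (indicator ref_cube z *\<^sub>R \<bar>v z\<bar> powr q) \<partial>lborel)"
    by (intro nn_integral_cong) (auto simp: indicator_def)
  also have "\<dots> = ennreal (LINT z:ref_cube|lborel. \<bar>v z\<bar> powr q)"
    unfolding set_lebesgue_integral_def by (intro nn_integral_eq_integral int) auto
  finally have "ennreal (\<bar>v x\<bar> powr q) \<le>
      ennreal (((q + 1) * (real k)\<^sup>2) ^ CARD('n) * (LINT z:ref_cube|lborel. \<bar>v z\<bar> powr q))"
    using q by (subst ennreal_mult') (simp_all flip: ennreal_power)
  moreover have "0 \<le> (LINT z:ref_cube|lborel. \<bar>v z\<bar> powr q)"
    unfolding set_lebesgue_integral_def by (intro integral_nonneg_AE) auto
  ultimately show ?thesis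
    using q by (subst (asm) ennreal_le_iff) auto
qed

section \<open>Interpolation between the exponents q and infinity\<close>

theorem lemma17:
  fixes v :: "real ^ 'n \<Rightarrow> real" and k :: nat and p q :: ereal
  assumes "k \<ge> 1"
    and "0 < q" and "q \<le> p"
    and "v \<in> Qk k"
  shows "Lnorm p v \<le>
    (if p = \<infinity> \<and> q = \<infinity> then 1
     else ((real_of_ereal q + 1) * (real k)\<^sup>2)
            powr (- real CARD('n) * (real_of_ereal (1 / p) - real_of_ereal (1 / q))))
    * Lnorm q v"
proof (cases q)
  case PInf
  then show ?thesis using assms(3) by simp
next
  case MInf
  then show ?thesis using assms(2) by simp
next
  case (real r)
  have r: "r > 0" using assms(2) real by simp
  let ?d = "CARD('n)"
  define C where "C = (r + 1) * (real k)\<^sup>2"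
  define I where "I = (LINT z:ref_cube|lborel. \<bar>v z\<bar> powr r)"
  have C: "C > 0" using r assms(1) by (simp add: C_def)
  have I: "I \<ge> 0"
    unfolding I_def set_lebesgue_integral_def by (intro integral_nonneg_AE) auto
  have Lq: "Lnorm (ereal r) v = I powr (1 / r)" by (simp add: Lnorm_def I_def)
  have inv: "real_of_ereal (1 / ereal s) = 1 / s" if "s > 0" for s
    using that by (simp add: one_ereal_def)
  \<comment> \<open>This pointwise form of the case of infinite \<open>p\<close> is also what the
    case of finite \<open>p\<close> rests on.\<close>
  have sup: "\<bar>v x\<bar> \<le> (C ^ ?d * I) powr (1 / r)" if x: "x \<in> ref_cube" for x
  proof -
    have "\<bar>v x\<bar> = (\<bar>v x\<bar> powr r) powr (1 / r)" using r by (simp add: powr_powr)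
    also have "\<dots> \<le> (C ^ ?d * I) powr (1 / r)"
      using Qk_powr_le_integral[OF assms(1) r assms(4) x] r
      by (intro powr_mono2) (auto simp: C_def I_def)
    finally show ?thesis .
  qed
  have "0 < p" using assms by auto
  then consider "p = \<infinity>" | s where "p = ereal s" "s = r" | s where "p = ereal s" "s > r"
    using assms(3) real by (cases p) fastforce+
  then show ?thesis
  proof cases
    case 1
    have ne: "(ref_cube :: (real ^ 'n) set) \<noteq> {}"
      by (simp add: ref_cube_eq box_ne_empty)
    have "Lnorm p v \<le> (C ^ ?d * I) powr (1 / r)"
      using sup ne by (auto simp: Lnorm_def 1 intro!: cSUP_least)
    also have "\<dots> = C powr (real ?d * (1 / r)) * I powr (1 / r)"
      using C I by (simp add: powr_mult powr_powr powr_realpow[symmetric] del: times_divide_eq_right)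
    finally show ?thesis using r by (simp add: 1 real Lq inv C_def)
  next
    case 2
    \<comment> \<open>The exponent is 0, and \<open>powr\<close> yields 1 because the base is
      positive; \<open>0 powr 0\<close> would be 0.\<close>
    then show ?thesis using r assms(1) by (simp add: real Lq)
  next
    case (3 s)
    have cont: "continuous_on UNIV v" using assms(4) by (rule Qk_continuous)
    \<comment> \<open>By \<open>sup\<close>, this bounds the power s - r of |v| on the cube.\<close>
    define B where "B = (C ^ ?d * I) powr ((s - r) / r)"
    have "\<bar>v x\<bar> powr s \<le> B * \<bar>v x\<bar> powr r" if x: "x \<in> ref_cube" for x
    proof -
      have "\<bar>v x\<bar> powr s = \<bar>v x\<bar> powr (s - r) * \<bar>v x\<bar> powr r"
        by (simp flip: powr_add)
      also have "\<bar>v x\<bar> powr (s - r) \<le> ((C ^ ?d * I) powr (1 / r)) powr (s - r)"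
        using sup[OF x] 3 by (intro powr_mono2) auto
      also have "\<dots> = B" by (simp add: powr_powr B_def)
      finally show ?thesis by (simp add: mult_right_mono)
    qed
    then have "(LINT z:ref_cube|lborel. \<bar>v z\<bar> powr s) \<le> (LINT z:ref_cube|lborel. B * \<bar>v z\<bar> powr r)"
      using r 3 cont
      by (intro set_integral_mono set_integrable_ref_cube continuous_on_abs_powr continuous_intros) auto
    also have "\<dots> = B * I" by (simp add: I_def)
    finally have "Lnorm p v \<le> (B * I) powr (1 / s)"
      using r 3 unfolding Lnorm_def
      by (auto intro!: powr_mono2 integral_nonneg_AE simp: set_lebesgue_integral_def)
    also have "\<dots> = C powr (real ?d * ((s - r) / r) * (1 / s)) * I powr (((s - r) / r + 1) * (1 / s))"
    proof -
      \<comment> \<open>Writing \<open>I\<close> as \<open>I powr 1\<close> lets the exponents add,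
        including the case I = 0.\<close>
      have "B * I = C powr (real ?d * ((s - r) / r)) * (I powr ((s - r) / r) * I powr 1)"
        using C I by (simp add: B_def powr_mult powr_powr powr_realpow[symmetric] del: times_divide_eq_right)
      also have "\<dots> = C powr (real ?d * ((s - r) / r)) * I powr ((s - r) / r + 1)"
        by (simp only: powr_add)
      finally show ?thesis by (simp add: powr_mult powr_powr)
    qed
    also have "((s - r) / r + 1) * (1 / s) = 1 / r"
      using r 3 by (simp add: field_simps)
    also have "real ?d * ((s - r) / r) * (1 / s) = - real ?d * (1 / s - 1 / r)"
      using r 3 by (simp add: field_simps)
    finally show ?thesis using r 3 by (simp add: real Lq inv C_def)
  qed
qed

end
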